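(* Any streaming algorithm for \textsc{Connectivity} in the AL model that works correctly on a family of graphs containing all "Simple AL-Conn" graphs $C_N(x,y)$ (for all $N$ and all $x,y\in\{0,1\}^N$) and uses $p$ passes over the stream requires $\Omega(n/p)$ bits of memory, where $n$ is the number of vertices.
   Context: For $N\ge1$ and $x,y\in\{0,1\}^N$, the graph $C_N(x,y)$ has $2N+4$ vertices $a,b,\ell_1,\dots,\ell_{N+1},r_1,\dots,r_{N+1}$ and edges: $\ell_ir_i$ for $1\le i\le N+1$; $a\ell_{N+1}$ and $br_{N+1}$; $a\ell_i$ exactly when $x_i=0$ ($1\le i\le N$); $br_i$ exactly when $y_i = 0$ ($1\le i\le N$). \textsc{Connectivity}: decide whether the graph is connected. In the Adjacency List (AL) streaming model the graph arrives as a sequence of vertices in arbitrary fixed order, each with the full list of its incident edges. A $p$-pass algorithm reads the sequence $p$ times with unlimited computation; memory is in bits. "Requires $\Omega(f)$ bits" means there is a constant $c_0>0$ such that every such algorithm uses at least $c_0f$ bits on some $n$-vertex input from the family, for all sufficiently large $n$ and all $p$.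
   Formalization: The bound is claimed only for n of the form 2N+4 with N≥1, the vertex counts of the graphs C_N(x,y); for other n, for example odd n, the family need not contain any n-vertex graph. *)

theory Defs
  imports Complex_Main "HOL-Library.FuncSet" "Graph_Theory.Graph_Theory"
begin

text \<open>
  A simple undirected graph is a \<open>pair_graph\<close>: a finite, loop-free, symmetric digraph in which
  the edge \<open>uv\<close> is present as the two arcs \<open>(u, v)\<close> and \<open>(v, u)\<close>.
\<close>

datatype conn_vertex = VA | VB | VL nat | VR nat

definition simple_al_conn :: "nat \<Rightarrow> (nat \<Rightarrow> nat) \<Rightarrow> (nat \<Rightarrow> nat) \<Rightarrow> conn_vertex pair_pre_digraph"
  where
  "simple_al_conn N x y =
    (let E = {(VL i, VR i) | i. i \<in> {1..N + 1}}
           \<union> {(VA, VL (N + 1)), (VB, VR (N + 1))}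
           \<union> {(VA, VL i) | i. i \<in> {1..N} \<and> x i = 0}
           \<union> {(VB, VR i) | i. i \<in> {1..N} \<and> y i = 0}
     in \<lparr> pverts = {VA, VB} \<union> VL ` {1..N + 1} \<union> VR ` {1..N + 1}, parcs = E \<union> E\<inverse> \<rparr>)"

text \<open>
  One item of an adjacency list stream is a vertex \<open>v\<close> together with the list of its incident
  edges, each written as the arc leaving \<open>v\<close>. Both the order of the vertices and the order inside
  each list are arbitrary.
\<close>

type_synonym 'v al_item = "'v \<times> ('v \<times> 'v) list"

definition al_stream :: "'v pair_pre_digraph \<Rightarrow> 'v al_item list \<Rightarrow> bool" where
  "al_stream G s \<longleftrightarrow>
     distinct (map fst s) \<and> set (map fst s) = pverts G \<and>
     (\<forall>(v, es) \<in> set s. distinct es \<and> set es = out_arcs G v)"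

text \<open>
  The memory contents are a bit string. Since computation is unlimited, the initial contents, the
  update and the answer are arbitrary functions. Their first argument is the number \<open>n\<close> of vertices;
  the second argument of \<open>step\<close> is the number of items read so far over all passes, so that an
  algorithm can recognise the end of a pass. Neither of these is charged as memory.
\<close>

record 'v al_algorithm =
  init :: "nat \<Rightarrow> bool list"
  step :: "nat \<Rightarrow> nat \<Rightarrow> bool list \<Rightarrow> 'v al_item \<Rightarrow> bool list"
  answer :: "nat \<Rightarrow> bool list \<Rightarrow> bool"

text \<open>
  In a stream in the above sense \<open>length s\<close> is the number of vertices, and reading the item with
  index \<open>t mod length s\<close> at time \<open>t\<close> amounts to repeated passes over the same sequence.
\<close>

primrec memory_at :: "'v al_algorithm \<Rightarrow> 'v al_item list \<Rightarrow> nat \<Rightarrow> bool list" where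
  "memory_at A s 0 = init A (length s)"
| "memory_at A s (Suc t) = step A (length s) t (memory_at A s t) (s ! (t mod length s))"

definition result :: "'v al_algorithm \<Rightarrow> nat \<Rightarrow> 'v al_item list \<Rightarrow> bool" where
  "result A p s = answer A (length s) (memory_at A s (p * length s))"

definition bits_used :: "'v al_algorithm \<Rightarrow> nat \<Rightarrow> 'v al_item list \<Rightarrow> nat" where
  "bits_used A p s = Max ((\<lambda>t. length (memory_at A s t)) ` {..p * length s})"

text \<open>The number of passes may depend on the number of vertices.\<close>

definition decides_connectivity ::
    "'v al_algorithm \<Rightarrow> (nat \<Rightarrow> nat) \<Rightarrow> 'v pair_pre_digraph set \<Rightarrow> bool" where
  "decides_connectivity A p \<F> \<longleftrightarrow>
     (\<forall>G \<in> \<F>. \<forall>s. al_stream G s \<longrightarrow> (result A (p (card (pverts G))) s \<longleftrightarrow> Digraph_Component.connected G))"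

end

theory Submission
  imports Defs
begin

text \<open>
  \<open>C\<^sub>N(x,y)\<close> is connected iff no index carries a 1 in both \<open>x\<close> and \<open>y\<close>. The lists of \<open>a\<close> and the
  \<open>\<ell>\<^sub>i\<close> depend on \<open>x\<close> only, those of \<open>b\<close> and the \<open>r\<^sub>i\<close> on \<open>y\<close> only, so streaming the former before
  the latter turns a \<open>p\<close>-pass algorithm into a two-party protocol for set disjointness whose
  transcript consists of the \<open>2p\<close> memory states at the half-passes. The pairs of \<open>x\<close> and its
  complement form a fooling set: equal transcripts for \<open>x\<close> and \<open>x'\<close> would give the same (positive)
  answer on \<open>x\<close> with the complement of \<open>x'\<close> and vice versa. So there are at least \<open>2\<^sup>N\<close> transcripts.
\<close>

section \<open>The graphs\<close>

lemma pverts_simple_al_conn: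
  "pverts (simple_al_conn N x y) = {VA, VB} \<union> VL ` {1..N + 1} \<union> VR ` {1..N + 1}"
  by (simp add: simple_al_conn_def Let_def)

lemma parcs_simple_al_conn:
  "parcs (simple_al_conn N x y) =
    (let E = {(VL i, VR i) | i. i \<in> {1..N + 1}}
           \<union> {(VA, VL (N + 1)), (VB, VR (N + 1))}
           \<union> {(VA, VL i) | i. i \<in> {1..N} \<and> x i = 0}
           \<union> {(VB, VR i) | i. i \<in> {1..N} \<and> y i = 0}
     in E \<union> E\<inverse>)"
  by (simp add: simple_al_conn_def Let_def)

text \<open>\<open>connected\<close> refers to the symmetric closure of the arcs. Each edge already
  contributes both arcs, so reachability may be studied in \<open>parcs\<close> itself.\<close>

lemma symcl_parcs_simple_al_conn:
  "(parcs (simple_al_conn N x y))\<^sup>s = parcs (simple_al_conn N x y)"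
  by (auto simp: symcl_def parcs_simple_al_conn Let_def)

lemma card_pverts_simple_al_conn: "card (pverts (simple_al_conn N x y)) = 2 * N + 4"
proof -
  have "card (VL ` {1..N + 1} \<union> VR ` {1..N + 1}) = (N + 1) + (N + 1)"
    by (subst card_Un_disjoint) (auto simp: card_image inj_on_def)
  moreover have "pverts (simple_al_conn N x y) =
      insert VA (insert VB (VL ` {1..N + 1} \<union> VR ` {1..N + 1}))"
    by (auto simp: pverts_simple_al_conn)
  ultimately show ?thesis
    by (auto simp: card_insert_if)
qed

text \<open>The path \<open>VA\<close>, \<open>VL (N + 1)\<close>, \<open>VR (N + 1)\<close>,
  \<open>VB\<close> is present for all inputs, and the edge between \<open>VL i\<close> and
  \<open>VR i\<close> is attached to it as soon as one of the two bits is 0. If neither is 0, this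
  edge is a component of its own.\<close>

lemma connected_simple_al_conn:
  "Digraph_Component.connected (simple_al_conn N x y) \<longleftrightarrow> (\<forall>i\<in>{1..N}. x i = 0 \<or> y i = 0)"
  (is "?conn \<longleftrightarrow> ?disj")
proof -
  let ?V = "pverts (simple_al_conn N x y)"
  let ?E = "parcs (simple_al_conn N x y)"
  let ?R = "rtrancl_on ?V ?E"
  have conv: "?conn \<longleftrightarrow> (\<forall>u\<in>?V. \<forall>v\<in>?V. (u, v) \<in> ?R)"
    by (auto simp: connected_conv symcl_parcs_simple_al_conn pverts_simple_al_conn)
  show ?thesis
  proof
    assume ?disj
    have step: "(u, w) \<in> ?R" if "(u, v) \<in> ?R" "(v, w) \<in> ?E" "w \<in> ?V" for u v w
      using that by (rule rtrancl_on_into_rtrancl_on)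
    have A: "(VA, VA) \<in> ?R"
      by (simp add: pverts_simple_al_conn)
    have L: "(VA, VL (N + 1)) \<in> ?R"
      by (rule step[OF A]) (auto simp: pverts_simple_al_conn parcs_simple_al_conn Let_def)
    have R: "(VA, VR (N + 1)) \<in> ?R"
      by (rule step[OF L]) (auto simp: pverts_simple_al_conn parcs_simple_al_conn Let_def)
    have B: "(VA, VB) \<in> ?R"
      by (rule step[OF R]) (auto simp: pverts_simple_al_conn parcs_simple_al_conn Let_def)
    have LR: "(VA, VL i) \<in> ?R \<and> (VA, VR i) \<in> ?R" if i: "i \<in> {1..N}" for i
    proof (cases "x i = 0")
      case True
      with i have *: "(VA, VL i) \<in> ?R"
        by (intro step[OF A]) (auto simp: pverts_simple_al_conn parcs_simple_al_conn Let_def)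
      moreover have "(VA, VR i) \<in> ?R"
        using i by (intro step[OF *]) (auto simp: pverts_simple_al_conn parcs_simple_al_conn Let_def)
      ultimately show ?thesis ..
    next
      case False
      with bspec[OF \<open>?disj\<close> i] have "y i = 0"
        by simp
      with i have *: "(VA, VR i) \<in> ?R"
        by (intro step[OF B]) (auto simp: pverts_simple_al_conn parcs_simple_al_conn Let_def)
      have "(VA, VL i) \<in> ?R"
        using i by (intro step[OF *]) (auto simp: pverts_simple_al_conn parcs_simple_al_conn Let_def)
      with * show ?thesis by simp
    qed
    have from_A: "(VA, v) \<in> ?R" if v: "v \<in> ?V" for v
    proof -
      consider "v = VA" | "v = VB" | "v = VL (N + 1)" | "v = VR (N + 1)"
        | i where "i \<in> {1..N}" "v = VL i \<or> v = VR i"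
        using v by (force simp: pverts_simple_al_conn le_Suc_eq)
      then show ?thesis
        by cases (use A B L R LR in auto)
    qed
    \<comment> \<open>Walks from \<open>VA\<close> can be reversed, so any two vertices are joined
      through \<open>VA\<close>.\<close>
    have "sym ?R"
      by (intro rtrancl_on_sym symI) (auto simp: parcs_simple_al_conn Let_def)
    then show ?conn
      unfolding conv by (meson from_A rtrancl_on_trans symE)
  next
    assume ?conn
    show ?disj
    proof (rule ccontr)
      assume "\<not> ?disj"
      then obtain i where i: "i \<in> {1..N}" "x i \<noteq> 0" "y i \<noteq> 0"
        by auto
      have "v \<in> {VL i, VR i}" if "(VL i, v) \<in> ?R" for v
        using that
      proof (induction rule: rtrancl_on_induct)
        case (step v w)
        then show ?case
          using i by (auto simp: parcs_simple_al_conn Let_def)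
      qed auto
      moreover have "(VL i, VA) \<in> ?R"
        using \<open>?conn\<close> i unfolding conv by (auto simp: pverts_simple_al_conn)
      ultimately show False
        by blast
    qed
  qed
qed

section \<open>The streams\<close>

text \<open>The list is chosen as a function of the arc set alone. Hence two graphs in which
  \<open>v\<close> has the same outgoing arcs yield literally the same item, which makes each half
  of the stream independent of the other player's input.\<close>

definition al_item_of :: "'v pair_pre_digraph \<Rightarrow> 'v \<Rightarrow> 'v al_item" where
  "al_item_of G v = (v, SOME es. distinct es \<and> set es = out_arcs G v)"

lemma al_stream_map_al_item_of:
  assumes "finite (parcs G)" "distinct vs" "set vs = pverts G"
  shows "al_stream G (map (al_item_of G) vs)"
proof -
  have "distinct (snd (al_item_of G v)) \<and> set (snd (al_item_of G v)) = out_arcs G v" for v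
  proof -
    have "finite (out_arcs G v)"
      using assms(1) by (auto simp: out_arcs_def)
    then have "\<exists>es. distinct es \<and> set es = out_arcs G v"
      using finite_distinct_list by blast
    from someI_ex[OF this] show ?thesis
      by (simp add: al_item_of_def)
  qed
  then show ?thesis
    using assms(2,3) by (auto simp: al_stream_def al_item_of_def comp_def)
qed

definition half_order :: "conn_vertex \<Rightarrow> (nat \<Rightarrow> conn_vertex) \<Rightarrow> nat \<Rightarrow> conn_vertex list" where
  "half_order c f N = c # map f [1..<N + 2]"

text \<open>One fixed order is enough for a lower bound, since a correct algorithm must handle every
  order.\<close>

definition conn_stream ::
    "nat \<Rightarrow> (nat \<Rightarrow> nat) \<Rightarrow> (nat \<Rightarrow> nat) \<Rightarrow> conn_vertex al_item list" where
  "conn_stream N x y =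
    map (al_item_of (simple_al_conn N x y)) (half_order VA VL N @ half_order VB VR N)"

lemma length_half_order [simp]: "length (half_order c f N) = N + 2"
  by (simp add: half_order_def)

lemma length_conn_stream: "length (conn_stream N x y) = 2 * N + 4"
  by (simp add: conn_stream_def)

lemma finite_parcs_simple_al_conn: "finite (parcs (simple_al_conn N x y))"
proof (rule finite_subset)
  show "parcs (simple_al_conn N x y) \<subseteq>
      pverts (simple_al_conn N x y) \<times> pverts (simple_al_conn N x y)"
    by (auto simp: pverts_simple_al_conn parcs_simple_al_conn Let_def)
qed (simp add: pverts_simple_al_conn)

lemma al_stream_conn_stream: "al_stream (simple_al_conn N x y) (conn_stream N x y)"
  unfolding conn_stream_def
proof (rule al_stream_map_al_item_of[OF finite_parcs_simple_al_conn])
  show "distinct (half_order VA VL N @ half_order VB VR N)"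
    by (auto simp: half_order_def distinct_map inj_on_def)
  show "set (half_order VA VL N @ half_order VB VR N) = pverts (simple_al_conn N x y)"
    by (auto simp: half_order_def pverts_simple_al_conn image_iff)
qed

text \<open>The arcs governed by \<open>y\<close> run between \<open>VB\<close> and some
  \<open>VR i\<close>, so none of them leaves a vertex of the left half.\<close>

lemma out_arcs_left:
  assumes "v \<in> insert VA (range VL)"
  shows "out_arcs (simple_al_conn N x y) v = out_arcs (simple_al_conn N x y') v"
  using assms by (auto simp: out_arcs_def parcs_simple_al_conn Let_def)

lemma out_arcs_right:
  assumes "v \<in> insert VB (range VR)"
  shows "out_arcs (simple_al_conn N x y) v = out_arcs (simple_al_conn N x' y) v"
  using assms by (auto simp: out_arcs_def parcs_simple_al_conn Let_def)

lemma conn_stream_nth_left: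
  assumes "i < N + 2"
  shows "conn_stream N x y ! i = conn_stream N x y' ! i"
proof -
  let ?v = "half_order VA VL N ! i"
  have "?v \<in> set (half_order VA VL N)"
    using assms by (intro nth_mem) simp
  then have "?v \<in> insert VA (range VL)"
    by (auto simp: half_order_def)
  then have "out_arcs (simple_al_conn N x y) ?v = out_arcs (simple_al_conn N x y') ?v"
    by (rule out_arcs_left)
  then show ?thesis
    using assms by (simp add: conn_stream_def al_item_of_def nth_append)
qed

lemma conn_stream_nth_right:
  assumes "N + 2 \<le> i" "i < 2 * N + 4"
  shows "conn_stream N x y ! i = conn_stream N x' y ! i"
proof -
  let ?v = "half_order VB VR N ! (i - (N + 2))"
  have "?v \<in> set (half_order VB VR N)"
    using assms by (intro nth_mem) simp
  then have "?v \<in> insert VB (range VR)"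
    by (auto simp: half_order_def)
  then have "out_arcs (simple_al_conn N x y) ?v = out_arcs (simple_al_conn N x' y) ?v"
    by (rule out_arcs_right)
  then show ?thesis
    using assms by (simp add: conn_stream_def al_item_of_def nth_append)
qed

section \<open>The fooling set argument\<close>

text \<open>This lets one player simulate a half-pass without knowing the other input:
  \<open>step\<close> sees only the length, the time, the memory and the current item.\<close>

lemma memory_at_cong_segment:
  assumes "length s = length s'" "memory_at A s t = memory_at A s' t"
    and "\<And>i. t \<le> i \<Longrightarrow> i < t + d \<Longrightarrow> s ! (i mod length s) = s' ! (i mod length s)"
  shows "memory_at A s (t + d) = memory_at A s' (t + d)"
  using assms(3) by (induction d) (use assms(1,2) in auto)

text \<open>With \<open>M\<close> the length of a half-pass, even blocks of time read the left half
  of the stream and odd blocks the right half.\<close>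

lemma half_pass_mod:
  fixes M k i :: nat
  assumes "k * M \<le> i" "i < k * M + M"
  shows "even k \<Longrightarrow> i mod (2 * M) < M" and "odd k \<Longrightarrow> M \<le> i mod (2 * M)"
proof -
  define r where "r = i - k * M"
  have r: "r < M" "i = k * M + r"
    using assms by (auto simp: r_def)
  show "i mod (2 * M) < M" if "even k"
  proof -
    obtain j where "k = 2 * j" using \<open>even k\<close> by blast
    then have "i = r + j * (2 * M)" using r by simp
    then show ?thesis using r by (simp only: mod_mult_self1) simp
  qed
  show "M \<le> i mod (2 * M)" if "odd k"
  proof -
    obtain j where "k = 2 * j + 1" using \<open>odd k\<close> by (elim oddE)
    then have "i = (M + r) + j * (2 * M)" using r by (simp add: algebra_simps)
    then show ?thesis using r by (simp only: mod_mult_self1) simp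
  qed
qed

text \<open>The cut-and-paste property of protocols: if \<open>(x, y)\<close> and
  \<open>(x', y')\<close> share a transcript, the mixed input \<open>(x, y')\<close> follows it too.
  In an even half-pass the items depend on \<open>x\<close> only, so the run is compared with
  \<open>(x, y)\<close>; in an odd one they depend on \<open>y'\<close> only, so it is compared with
  \<open>(x', y')\<close>, and the shared transcript leads back to \<open>(x, y)\<close>.\<close>

lemma memory_at_cross:
  assumes eq: "\<And>k. k \<in> {1..K} \<Longrightarrow>
      memory_at A (conn_stream N x y) (k * (N + 2)) = memory_at A (conn_stream N x' y') (k * (N + 2))"
    and "k \<le> K"
  shows "memory_at A (conn_stream N x y') (k * (N + 2)) = memory_at A (conn_stream N x y) (k * (N + 2))"
  using \<open>k \<le> K\<close>
proof (induction k)
  case 0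
  then show ?case
    by (simp add: length_conn_stream)
next
  case (Suc k)
  let ?M = "N + 2"
  have IH: "memory_at A (conn_stream N x y') (k * ?M) = memory_at A (conn_stream N x y) (k * ?M)"
    using Suc by simp
  \<comment> \<open>Time 0 is not part of the transcript, but \<open>init\<close> sees only the
    length of the stream, which is the same for all inputs.\<close>
  have eq_k: "memory_at A (conn_stream N x y) (k * ?M) = memory_at A (conn_stream N x' y') (k * ?M)"
    using eq[of k] Suc.prems by (cases "k = 0") (auto simp: length_conn_stream)
  have Suc_k: "Suc k * ?M = k * ?M + ?M"
    by simp
  have len: "length (conn_stream N u v) = 2 * ?M" for u v
    by (simp add: length_conn_stream)
  have "memory_at A (conn_stream N x y') (k * ?M + ?M) = memory_at A (conn_stream N x y) (k * ?M + ?M)"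
  proof (cases "even k")
    case True
    show ?thesis
    proof (rule memory_at_cong_segment)
      fix i assume "k * ?M \<le> i" "i < k * ?M + ?M"
      with True have "i mod (2 * ?M) < ?M"
        by (intro half_pass_mod(1)[of k])
      then show "conn_stream N x y' ! (i mod length (conn_stream N x y')) =
          conn_stream N x y ! (i mod length (conn_stream N x y'))"
        unfolding len by (rule conn_stream_nth_left)
    qed (simp_all only: len IH)
  next
    case False
    have "memory_at A (conn_stream N x y') (k * ?M + ?M) = memory_at A (conn_stream N x' y') (k * ?M + ?M)"
    proof (rule memory_at_cong_segment)
      fix i assume "k * ?M \<le> i" "i < k * ?M + ?M"
      with False have "?M \<le> i mod (2 * ?M)"
        by (intro half_pass_mod(2)[of k])
      moreover have "i mod (2 * ?M) < 2 * ?M"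
        by (rule mod_less_divisor) simp
      ultimately show "conn_stream N x y' ! (i mod length (conn_stream N x y')) =
          conn_stream N x' y' ! (i mod length (conn_stream N x y'))"
        unfolding len by (intro conn_stream_nth_right) auto
    qed (simp_all only: len IH eq_k)
    also have "\<dots> = memory_at A (conn_stream N x y) (k * ?M + ?M)"
      using eq[of "Suc k"] Suc.prems unfolding Suc_k by simp
    finally show ?thesis .
  qed
  then show ?case
    unfolding Suc_k .
qed

lemma length_memory_at_le_bits_used:
  "t \<le> p * length s \<Longrightarrow> length (memory_at A s t) \<le> bits_used A p s"
  unfolding bits_used_def by (intro Max_ge) auto

lemma card_bool_lists_le: "card {bs :: bool list. length bs \<le> m} < 2 ^ (m + 1)"
proof -
  have "card {bs :: bool list. length bs \<le> m} = (\<Sum>i\<le>m. 2 ^ i)"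
    using card_lists_length_le[of "UNIV :: bool set" m] by simp
  also have "\<dots> < 2 ^ (m + 1)"
    by (induction m) auto
  finally show ?thesis .
qed

lemma finite_bool_lists_le: "finite {bs :: bool list. length bs \<le> m}"
  using finite_lists_length_le[of "UNIV :: bool set" m] by simp

lemma fooling_set_bound:
  assumes correct: "\<And>x y. x \<in> {1..N} \<rightarrow>\<^sub>E {0, 1} \<Longrightarrow> y \<in> {1..N} \<rightarrow>\<^sub>E {0, 1} \<Longrightarrow>
      result A p (conn_stream N x y) \<longleftrightarrow> (\<forall>i\<in>{1..N}. x i = 0 \<or> y i = 0)"
    and bits: "\<And>x y. x \<in> {1..N} \<rightarrow>\<^sub>E {0, 1} \<Longrightarrow> y \<in> {1..N} \<rightarrow>\<^sub>E {0, 1} \<Longrightarrow>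
      bits_used A p (conn_stream N x y) \<le> m"
    and "N \<ge> 1"
  shows "N \<le> 4 * m * p"
proof -
  let ?X = "{1..N} \<rightarrow>\<^sub>E {0, 1 :: nat}"
  let ?B = "{bs :: bool list. length bs \<le> m}"
  \<comment> \<open>Both functions are restricted to their index sets so that they are extensional
    and can be counted by \<open>card_PiE\<close>. The last entry of \<open>T x\<close>, at
    \<open>k = 2 * p\<close>, is the memory that determines the answer.\<close>
  define co :: "(nat \<Rightarrow> nat) \<Rightarrow> nat \<Rightarrow> nat" where "co x = (\<lambda>i\<in>{1..N}. 1 - x i)" for x
  define T where "T x = (\<lambda>k\<in>{1..2 * p}. memory_at A (conn_stream N x (co x)) (k * (N + 2)))" for x
  have co: "co x \<in> ?X" if "x \<in> ?X" for x
    using that by (auto simp: co_def)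
  have half_passes: "p * length (conn_stream N x y) = (2 * p) * (N + 2)" for x y
    by (simp add: length_conn_stream algebra_simps)
  \<comment> \<open>The mixed input of \<open>x\<close> and \<open>co x'\<close> ends in the same
    memory as \<open>x\<close> and \<open>co x\<close>, hence is accepted; by correctness it must
    then be disjoint.\<close>
  have disj: "x i = 0 \<or> co x' i = 0" if "x \<in> ?X" "x' \<in> ?X" "T x = T x'" "i \<in> {1..N}" for x x' i
  proof -
    have "memory_at A (conn_stream N x (co x)) (k * (N + 2)) =
        memory_at A (conn_stream N x' (co x')) (k * (N + 2))" if "k \<in> {1..2 * p}" for k
      using fun_cong[OF \<open>T x = T x'\<close>, of k] that by (simp add: T_def)
    then have "memory_at A (conn_stream N x (co x')) ((2 * p) * (N + 2)) =
        memory_at A (conn_stream N x (co x)) ((2 * p) * (N + 2))"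
      by (rule memory_at_cross[where K = "2 * p"]) auto
    then have "result A p (conn_stream N x (co x')) \<longleftrightarrow> result A p (conn_stream N x (co x))"
      unfolding result_def half_passes by (simp add: length_conn_stream)
    moreover have "\<forall>i\<in>{1..N}. x i = 0 \<or> co x i = 0"
      using \<open>x \<in> ?X\<close> by (force simp: co_def PiE_def Pi_def)
    ultimately have "result A p (conn_stream N x (co x'))"
      using correct[OF \<open>x \<in> ?X\<close> co[OF \<open>x \<in> ?X\<close>]] by simp
    with correct[OF \<open>x \<in> ?X\<close> co[OF \<open>x' \<in> ?X\<close>]] \<open>i \<in> {1..N}\<close> show ?thesis
      by simp
  qed
  have "inj_on T ?X"
  proof (rule inj_onI)
    fix x x' assume *: "x \<in> ?X" "x' \<in> ?X" "T x = T x'"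
    show "x = x'"
    proof (rule PiE_ext[OF *(1,2)])
      fix i assume i: "i \<in> {1..N}"
      have "x i \<in> {0, 1}" "x' i \<in> {0, 1}"
        using *(1,2) i by (blast dest: PiE_mem)+
      \<comment> \<open>Disjointness of \<open>x\<close> from \<open>co x'\<close> says that
        \<open>x\<close> is pointwise at most \<open>x'\<close>; exchanging the two gives the
        converse.\<close>
      then show "x i = x' i"
        using disj[OF * i] disj[OF *(2,1) *(3)[symmetric] i] i by (auto simp: co_def)
    qed
  qed
  moreover have "T ` ?X \<subseteq> {1..2 * p} \<rightarrow>\<^sub>E ?B"
  proof
    fix f assume "f \<in> T ` ?X"
    then obtain x where x: "x \<in> ?X" "f = T x" by blast
    have "length (memory_at A (conn_stream N x (co x)) (k * (N + 2))) \<le> m" if "k \<in> {1..2 * p}" for k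
    proof -
      have "k * (N + 2) \<le> p * length (conn_stream N x (co x))"
        unfolding half_passes using that by (intro mult_right_mono) auto
      from length_memory_at_le_bits_used[OF this] bits[OF x(1) co[OF x(1)]] show ?thesis
        by (rule order_trans)
    qed
    then show "f \<in> {1..2 * p} \<rightarrow>\<^sub>E ?B"
      by (auto simp: x(2) T_def)
  qed
  ultimately have "card ?X \<le> card ({1..2 * p} \<rightarrow>\<^sub>E ?B)"
    by (intro card_inj_on_le[of T]) (auto intro!: finite_PiE simp: finite_bool_lists_le)
  then have count: "2 ^ N \<le> card ?B ^ (2 * p)"
    by (simp add: card_PiE numeral_2_eq_2)
  show ?thesis
  proof (cases "m = 0")
    \<comment> \<open>The estimate \<open>m + 1 \<le> 2 * m\<close> below needs a positive
      \<open>m\<close>. With \<open>m = 0\<close> only the empty string is available, so there is a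
      single transcript, too few for \<open>N \<ge> 1\<close>.\<close>
    case True
    with count have "(2 :: nat) ^ N \<le> 1"
      by simp
    with \<open>N \<ge> 1\<close> show ?thesis
      by (metis not_less one_less_numeral_iff one_less_power semiring_norm(76) less_le_trans zero_less_one)
  next
    case False
    note count
    also have "card ?B ^ (2 * p) \<le> (2 ^ (m + 1)) ^ (2 * p)"
      using card_bool_lists_le[of m] by (intro power_mono) auto
    also have "\<dots> = 2 ^ ((m + 1) * (2 * p))"
      by (rule power_mult[symmetric])
    finally have "N \<le> (m + 1) * (2 * p)"
      by simp
    also have "\<dots> \<le> (2 * m) * (2 * p)"
      using False by (intro mult_right_mono) auto
    finally show ?thesis
      by simp
  qed
qed

theorem theorem34:
  shows "\<exists>c\<^sub>0 > (0 :: real). \<exists>n\<^sub>0 :: nat.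
    \<forall>(\<F> :: conn_vertex pair_pre_digraph set) (A :: conn_vertex al_algorithm) (p :: nat \<Rightarrow> nat).
      (\<forall>G \<in> \<F>. pair_graph G) \<longrightarrow>
      (\<forall>N \<ge> 1. \<forall>x \<in> {1..N} \<rightarrow>\<^sub>E {0, 1}. \<forall>y \<in> {1..N} \<rightarrow>\<^sub>E {0, 1}. simple_al_conn N x y \<in> \<F>) \<longrightarrow>
      (\<forall>n. p n \<ge> 1) \<longrightarrow>
      decides_connectivity A p \<F> \<longrightarrow>
      (\<forall>n \<ge> n\<^sub>0. (\<exists>N \<ge> 1. n = 2 * N + 4) \<longrightarrow>
        (\<exists>G \<in> \<F>. card (pverts G) = n \<and>
          (\<exists>s. al_stream G s \<and> real (bits_used A (p n) s) \<ge> c\<^sub>0 * (real n / real (p n)))))"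
\<comment> \<open>The constant comes from \<open>N \<le> 4 * m * p n\<close> and
  \<open>n = 2 * N + 4 \<le> 6 * N\<close>, the latter valid for every \<open>N \<ge> 1\<close>; so
  \<open>n\<^sub>0\<close> can be 0.\<close>
proof (rule exI[of _ "1 / 24"], intro conjI exI[of _ 0] allI impI; (elim exE conjE)?)
  fix \<F> :: "conn_vertex pair_pre_digraph set" and A :: "conn_vertex al_algorithm"
    and p :: "nat \<Rightarrow> nat" and n N :: nat
  assume family: "\<forall>N \<ge> 1. \<forall>x \<in> {1..N} \<rightarrow>\<^sub>E {0, 1}. \<forall>y \<in> {1..N} \<rightarrow>\<^sub>E {0, 1}. simple_al_conn N x y \<in> \<F>"
    and p: "\<forall>n. p n \<ge> 1"
    and dec: "decides_connectivity A p \<F>"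
    and N: "1 \<le> N" and n: "n = 2 * N + 4"
  let ?X = "{1..N} \<rightarrow>\<^sub>E {0, 1 :: nat}"
  define b where "b = (\<lambda>(x, y). bits_used A (p n) (conn_stream N x y))"
  \<comment> \<open>The maximum over the finitely many inputs is attained, and an input attaining it
    supplies the required graph and stream.\<close>
  define m where "m = Max (b ` (?X \<times> ?X))"
  have fin: "finite (?X \<times> ?X)"
    by (intro finite_cartesian_product finite_PiE) auto
  have "?X \<times> ?X \<noteq> {}"
    by (simp add: PiE_eq_empty_iff)
  with fin have "m \<in> b ` (?X \<times> ?X)"
    unfolding m_def by (intro Max_in) auto
  then obtain x y where xy: "x \<in> ?X" "y \<in> ?X" "bits_used A (p n) (conn_stream N x y) = m"
    by (auto simp: b_def)
  have "N \<le> 4 * m * p n"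
  proof (rule fooling_set_bound[OF _ _ N])
    fix u v assume uv: "u \<in> ?X" "v \<in> ?X"
    have "simple_al_conn N u v \<in> \<F>"
      using family N uv by blast
    with dec al_stream_conn_stream[of N u v]
    have "result A (p (card (pverts (simple_al_conn N u v)))) (conn_stream N u v) \<longleftrightarrow>
        Digraph_Component.connected (simple_al_conn N u v)"
      unfolding decides_connectivity_def by blast
    then show "result A (p n) (conn_stream N u v) \<longleftrightarrow> (\<forall>i\<in>{1..N}. u i = 0 \<or> v i = 0)"
      by (simp only: card_pverts_simple_al_conn connected_simple_al_conn n)
    have "b (u, v) \<le> m"
      unfolding m_def using fin uv by (intro Max_ge) auto
    then show "bits_used A (p n) (conn_stream N u v) \<le> m"
      by (simp add: b_def)
  qed
  then have "n \<le> 24 * (m * p n)"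
    using N n by linarith
  then have "real n \<le> 24 * (real m * real (p n))"
    by (metis of_nat_le_iff of_nat_mult of_nat_numeral)
  moreover have "real (p n) > 0"
    using p by (simp add: Suc_le_lessD)
  ultimately have "1 / 24 * (real n / real (p n)) \<le> real m"
    by (simp add: field_simps)
  moreover have "simple_al_conn N x y \<in> \<F>"
    using family N xy by blast
  ultimately show "\<exists>G \<in> \<F>. card (pverts G) = n \<and>
      (\<exists>s. al_stream G s \<and> real (bits_used A (p n) s) \<ge> 1 / 24 * (real n / real (p n)))"
    using al_stream_conn_stream[of N x y] xy(3)
    by (intro bexI[of _ "simple_al_conn N x y"]) (auto simp: card_pverts_simple_al_conn n)
qed simp

end
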